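(* Let $g(z)$ be a power series with real coefficients and $g(0)\ne0$, let $a\neq0$ be real, and let $\{G_n(s)\}_{n\ge0}$ be the Appell sequence for the pair $(g,az)$, i.e. $\sum_{n\ge0}G_n(s)\frac{z^n}{n!}=g(z)e^{asz}$. (1) If $$g(z)=2\rho(z)\bigl(1+\tanh(kz)\bigr),$$ where $\rho(z)$ is any even function (power series with real coefficients) with $\rho(0)=1$ and $k\in\mathbb{R}$, then for every $n\ge1$ all the zeros of $G_n(s)$ are symmetric with respect to the line $\operatorname{Re}s=-\frac{k}{a}$. (2) Conversely, if all the zeros of $G_n(s)$ ($n\ge1$) are symmetric with respect to a vertical line in $\mathbb{C}$, then there exist an even function $\rho(z)$ with $\rho(0)=1$ and a $k\in\mathbb{R}$ such that $g(z)=2\rho(z)\bigl(1+\tanh(kz)\bigr)$.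
   Context: The zeros of a polynomial are symmetric with respect to the vertical line $\operatorname{Re}s=\kappa$ ($\kappa\in\mathbb{R}$) if the multiset of its complex zeros (counted with multiplicity) is invariant under the reflection $s\mapsto 2\kappa-\overline{s}$. In (2) the vertical line is the same for all $n\ge1$. Power series are formal; "even" means $\rho(-z)=\rho(z)$.
   Formalization: In (2) the conclusion is proved as g(z) = (g(0)/2)·2ρ(z)(1+tanh(kz)): as printed it forces g(0)=2 and fails for g=1, where G_n(s)=(as)^n has zeros symmetric about Re s=0; for g(0)=2 it is the printed claim. *)

theory Defs
  imports
    "HOL-Computational_Algebra.Formal_Power_Series"
    "HOL-Computational_Algebra.Polynomial"
    Complex_Main
begin

unbundle fps_syntax

definition fps_complex_of_real :: "real fps \<Rightarrow> complex fps" where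
  "fps_complex_of_real g = Abs_fps (\<lambda>n. complex_of_real (g $ n))"

text \<open>
  \<open>appell_sequence g a G\<close>: the exponential generating function of \<open>G\<close>, evaluated at any
  complex \<open>s\<close>, is the formal power series \<open>g(z) * exp(a * s * z)\<close> in \<open>z\<close>. As this is required
  for all \<open>s\<close>, it determines the polynomials \<open>G n\<close>.
\<close>

definition appell_sequence :: "real fps \<Rightarrow> real \<Rightarrow> (nat \<Rightarrow> complex poly) \<Rightarrow> bool" where
  "appell_sequence g a G \<longleftrightarrow>
     (\<forall>s. Abs_fps (\<lambda>n. poly (G n) s / fact n)
            = fps_complex_of_real g * fps_exp (complex_of_real a * s))"

lemma appell_sequence_exists: "\<exists>G. appell_sequence g a G"
proof -
  define G :: "nat \<Rightarrow> complex poly" where "G n = (\<Sum>i=0..n.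
      monom (fact n * of_real (g $ i) * of_real a ^ (n - i) / fact (n - i)) (n - i))"
    for n
  have "appell_sequence g a G"
    unfolding appell_sequence_def fps_eq_iff fps_complex_of_real_def G_def
    by (auto simp: fps_mult_nth poly_sum poly_monom sum_divide_distrib power_mult_distrib
             intro!: sum.cong)
  then show ?thesis by blast
qed

definition fps_even :: "'a :: comm_ring_1 fps \<Rightarrow> bool" where
  "fps_even r \<longleftrightarrow> fps_compose r (- fps_X) = r"

text \<open>
  The formal expansion of \<open>tanh (c * z)\<close>; the denominator has constant coefficient 2, so
  this is a genuine quotient of power series.
\<close>

definition fps_tanh :: "'a :: field_char_0 \<Rightarrow> 'a fps" where
  "fps_tanh c = (fps_exp c - fps_exp (- c)) / (fps_exp c + fps_exp (- c))"

definition zeros_symmetric :: "real \<Rightarrow> complex poly \<Rightarrow> bool" where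
  "zeros_symmetric \<kappa> p \<longleftrightarrow>
     image_mset (\<lambda>s. 2 * complex_of_real \<kappa> - cnj s) (proots p) = proots p"

end

theory Submission
  imports Defs "HOL-Computational_Algebra.Fundamental_Theorem_Algebra"
begin

text \<open>
  The polynomials \<open>G n\<close> are real of exact degree \<open>n\<close>, so their zeros are symmetric with
  respect to \<open>Re s = \<kappa>\<close> iff \<open>G n (2 \<kappa> - s) = (-1) ^ n * G n s\<close>. For the generating function
  this says \<open>g z * exp (a * (2 * \<kappa> - s) * z) = g (- z) * exp (- a * s * z)\<close>, i.e. that
  \<open>g z * exp (a * \<kappa> * z)\<close> is even. Since \<open>1 + tanh (k * z) = exp (k * z) / cosh (k * z)\<close> and
  \<open>cosh (k * z)\<close> is even, evenness of \<open>g z * exp (- k * z)\<close> is what the representation of \<open>g\<close>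
  by \<open>\<rho>\<close> and \<open>k\<close> amounts to.
\<close>

section \<open>Reflection symmetry of zeros as a functional equation\<close>

lemma proots_prod_mset_linear:
  fixes M :: "'a :: idom multiset"
  shows "proots (\<Prod>x\<in>#M. [:- x, 1:]) = M"
proof (induction M)
  case (add x M)
  have "(\<Prod>x\<in>#M. [:- x, 1:]) \<noteq> 0"
    by auto
  then have "proots ([:- x, 1:] * (\<Prod>x\<in>#M. [:- x, 1:])) = {#x#} + M"
    using add.IH by (subst proots_mult) auto
  then show ?case
    by (simp only: image_mset_add_mset prod_mset.add_mset) simp
qed simp

lemma poly_prod_mset_linear:
  fixes M :: "'a :: idom multiset"
  shows "poly (\<Prod>x\<in>#M. [:- x, 1:]) s = (\<Prod>x\<in>#M. s - x)"
  by (induction M) (auto simp del: mult_pCons_left)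

lemma poly_eq_prod_proots:
  fixes p :: "complex poly"
  shows "poly p s = lead_coeff p * (\<Prod>x\<in>#proots p. s - x)"
  by (metis complex_poly_decompose_multiset poly_smult poly_prod_mset_linear)

text \<open>Each factor contributes one sign, since \<open>cnj (r - cnj s - x)\<close> is the
  negative of \<open>s - (cnj r - cnj x)\<close>. With \<open>r = 2 * \<kappa>\<close> the points on
  the right are the mirror images of those in \<open>M\<close>.\<close>

lemma cnj_prod_mset_reflect:
  "cnj (\<Prod>x\<in>#M. r - cnj s - x) = (-1) ^ size M * (\<Prod>x\<in>#image_mset (\<lambda>x. cnj r - cnj x) M. s - x)"
proof (induction M)
  case (add x M)
  have "cnj (r - cnj s - x) = - (s - (cnj r - cnj x))"
    by simp
  then show ?case
    by (simp only: image_mset_add_mset prod_mset.add_mset complex_cnj_mult add.IH size_add_mset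
        power_Suc) (simp add: mult_ac del: minus_diff_eq)
qed simp

text \<open>Factoring \<open>p\<close> over its zeros turns the left side of the equation into the
  product over the reflected zeros, with sign \<open>(-1) ^ degree p\<close>. The leading
  coefficient survives conjugation because it is real, so it cancels for
  \<open>p \<noteq> 0\<close>, and monic products agree only if their multisets of zeros do.\<close>

lemma zeros_symmetric_iff:
  assumes "lead_coeff p \<in> \<real>"
  shows "zeros_symmetric \<kappa> p \<longleftrightarrow>
    (\<forall>s. cnj (poly p (2 * of_real \<kappa> - cnj s)) = (-1) ^ degree p * poly p s)"
proof (cases "p = 0")
  case True
  then show ?thesis by (simp add: zeros_symmetric_def)
next
  case False
  define P where "P = proots p"
  define Q where "Q = image_mset (\<lambda>x. 2 * of_real \<kappa> - cnj x) P"
  have lc: "cnj (lead_coeff p) = lead_coeff p" "lead_coeff p \<noteq> 0"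
    using assms False by (auto simp: Reals_cnj_iff)
  have "cnj (poly p (2 * of_real \<kappa> - cnj s)) = lead_coeff p * ((-1) ^ degree p * (\<Prod>x\<in>#Q. s - x))"
    for s
    unfolding poly_eq_prod_proots[of p] complex_cnj_mult lc cnj_prod_mset_reflect
    by (simp add: Q_def P_def size_proots_complex)
  then have "(\<forall>s. cnj (poly p (2 * of_real \<kappa> - cnj s)) = (-1) ^ degree p * poly p s)
      \<longleftrightarrow> (\<forall>s. (\<Prod>x\<in>#Q. s - x) = (\<Prod>x\<in>#P. s - x))"
    using lc by (simp add: poly_eq_prod_proots[of p] P_def mult.left_commute)
  also have "\<dots> \<longleftrightarrow> poly (\<Prod>x\<in>#Q. [:- x, 1:]) = poly (\<Prod>x\<in>#P. [:- x, 1:])"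
    by (simp add: fun_eq_iff poly_prod_mset_linear)
  also have "\<dots> \<longleftrightarrow> Q = P"
    by (metis poly_eq_poly_eq_iff proots_prod_mset_linear)
  finally show ?thesis
    by (simp add: zeros_symmetric_def Q_def P_def)
qed

section \<open>Power series: complexification, exponentials and evenness\<close>

lemma fps_complex_of_real_nth [simp]: "fps_complex_of_real g $ n = of_real (g $ n)"
  by (simp add: fps_complex_of_real_def)

lemma fps_complex_of_real_eq_iff [simp]:
  "fps_complex_of_real f = fps_complex_of_real g \<longleftrightarrow> f = g"
  by (simp add: fps_eq_iff)

lemma fps_complex_of_real_mult:
  "fps_complex_of_real (f * g) = fps_complex_of_real f * fps_complex_of_real g"
  by (simp add: fps_eq_iff fps_mult_nth)

lemma fps_complex_of_real_exp:
  "fps_complex_of_real (fps_exp c) = fps_exp (of_real c)"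
  by (simp add: fps_eq_iff)

lemma fps_complex_of_real_reflect:
  "fps_complex_of_real (f oo - fps_X) = fps_complex_of_real f oo - fps_X"
  by (simp add: fps_eq_iff fps_compose_uminus')

lemma fps_exp_mult_minus [simp]: "fps_exp c * fps_exp (- c :: 'a :: field_char_0) = 1"
  by (simp flip: fps_exp_add_mult)

lemma fps_mult_exp_eq_iff:
  fixes f h :: "'a :: field_char_0 fps"
  shows "f * fps_exp c = h \<longleftrightarrow> f = h * fps_exp (- c)"
  using fps_exp_mult_minus[of c] by (auto simp: mult.assoc mult.commute[of "fps_exp (- c)"])

lemma fps_even_mult_exp_iff:
  fixes g :: "'a :: field_char_0 fps"
  shows "fps_even (g * fps_exp c) \<longleftrightarrow> g * fps_exp (2 * c) = g oo - fps_X"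
proof -
  have exp2: "fps_exp (2 * c) = fps_exp c * fps_exp c"
    by (simp flip: fps_exp_add_mult)
  have "fps_even (g * fps_exp c) \<longleftrightarrow> (g oo - fps_X) * fps_exp (- c) = g * fps_exp c"
    by (simp add: fps_even_def fps_compose_mult_distrib)
  also have "\<dots> \<longleftrightarrow> g * fps_exp (2 * c) = g oo - fps_X"
    unfolding fps_mult_exp_eq_iff exp2 by (auto simp: mult.assoc)
  finally show ?thesis .
qed

section \<open>Symmetric zeros of Appell polynomials\<close>

context
  fixes g :: "real fps" and a :: real and G :: "nat \<Rightarrow> complex poly"
  assumes appell: "appell_sequence g a G"
begin

lemma appell_poly:
  "poly (G n) s = fact n * (fps_complex_of_real g * fps_exp (of_real a * s)) $ n"
proof -
  have "Abs_fps (\<lambda>n. poly (G n) s / fact n) $ n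
      = (fps_complex_of_real g * fps_exp (of_real a * s)) $ n"
    using appell unfolding appell_sequence_def by simp
  then show ?thesis by (simp add: field_simps)
qed

text \<open>Needed for two facts: all coefficients are real, and the top one is
  \<open>g $ 0 * a ^ n\<close>, which fixes the degree.\<close>

lemma appell_coeff:
  "coeff (G n) j = (if j \<le> n then of_real (fact n * g $ (n - j) * a ^ j / fact j) else 0)"
proof -
  define H where "H = (\<Sum>j=0..n. monom (complex_of_real (fact n * g $ (n - j) * a ^ j / fact j)) j)"
  have "poly (G n) s = poly H s" for s
    unfolding appell_poly mult.commute[of "fps_complex_of_real g"] fps_mult_nth
    by (simp add: H_def poly_sum poly_monom sum_distrib_left power_mult_distrib mult_ac)
  then have "G n = H"
    by (simp add: poly_eq_poly_eq_iff[symmetric] fun_eq_iff)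
  then show ?thesis
    by (simp add: H_def coeff_sum)
qed

lemma appell_degree:
  assumes "g $ 0 \<noteq> 0" "a \<noteq> 0"
  shows "degree (G n) = n"
  using assms by (intro antisym degree_le le_degree) (auto simp: appell_coeff)

lemma appell_zeros_symmetric_iff:
  assumes "g $ 0 \<noteq> 0" "a \<noteq> 0"
  shows "(\<forall>n\<ge>1. zeros_symmetric \<kappa> (G n)) \<longleftrightarrow> fps_even (g * fps_exp (a * \<kappa>))"
proof -
  define h where "h = fps_complex_of_real g"
  have cnj_poly: "cnj (poly (G n) s) = poly (G n) (cnj s)" for n s
    by (simp add: appell_poly fps_mult_nth)
  have sym_iff: "zeros_symmetric \<kappa> (G n) \<longleftrightarrow>
      (\<forall>s. poly (G n) (2 * of_real \<kappa> - s) = (-1) ^ n * poly (G n) s)" for n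
  proof -
    have "lead_coeff (G n) \<in> \<real>"
      by (metis appell_coeff Reals_0 Reals_of_real)
    then show ?thesis
      by (simp add: zeros_symmetric_iff cnj_poly appell_degree[OF assms])
  qed
  \<comment> \<open>\<open>G 0\<close> is constant, so the functional equation is automatic for
    \<open>n = 0\<close>. It can therefore be demanded for all \<open>n\<close>, that is, for every
    coefficient of a generating function.\<close>
  have "poly (G 0) s = poly (G 0) t" for s t
    by (simp add: appell_poly)
  then have "(\<forall>n\<ge>1. zeros_symmetric \<kappa> (G n)) \<longleftrightarrow>
      (\<forall>n s. poly (G n) (2 * of_real \<kappa> - s) = (-1) ^ n * poly (G n) s)"
    unfolding sym_iff by (metis One_nat_def Suc_leI mult_1 neq0_conv power_0)
  \<comment> \<open>The signs \<open>(-1) ^ n\<close> are the effect of substituting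
    \<open>- fps_X\<close>.\<close>
  also have "\<dots> \<longleftrightarrow> (\<forall>s. h * fps_exp (of_real a * (2 * of_real \<kappa> - s))
      = (h * fps_exp (of_real a * s)) oo - fps_X)"
    by (auto simp: fps_eq_iff appell_poly fps_compose_uminus' h_def)
  also have "\<dots> \<longleftrightarrow> (\<forall>s. h * fps_exp (2 * of_real (a * \<kappa>)) * fps_exp (- (of_real a * s))
      = (h oo - fps_X) * fps_exp (- (of_real a * s)))"
    by (simp add: fps_compose_mult_distrib algebra_simps flip: fps_exp_add_mult)
  \<comment> \<open>The exponential in \<open>s\<close> is a common nonzero factor; cancelling it
    removes \<open>s\<close>.\<close>
  also have "\<dots> \<longleftrightarrow> h * fps_exp (2 * of_real (a * \<kappa>)) = h oo - fps_X"
    by simp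
  also have "\<dots> \<longleftrightarrow> fps_complex_of_real (g * fps_exp (2 * (a * \<kappa>))) = fps_complex_of_real (g oo - fps_X)"
    by (simp only: h_def fps_complex_of_real_mult fps_complex_of_real_exp
        fps_complex_of_real_reflect of_real_mult of_real_numeral)
  also have "\<dots> \<longleftrightarrow> fps_even (g * fps_exp (a * \<kappa>))"
    by (simp add: fps_even_mult_exp_iff)
  finally show ?thesis .
qed

end

section \<open>The hyperbolic tangent representation\<close>

lemma one_plus_fps_tanh:
  "(1 + fps_tanh k) * (fps_exp k + fps_exp (- k)) = 2 * fps_exp (k :: 'a :: field_char_0)"
proof -
  define C where "C = fps_exp k + fps_exp (- k)"
  have "C $ 0 \<noteq> 0" by (simp add: C_def)
  then have "fps_tanh k * C = fps_exp k - fps_exp (- k)"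
    by (simp add: fps_tanh_def C_def fps_divide_unit mult.assoc inverse_mult_eq_1)
  then show ?thesis
    by (simp add: C_def[symmetric] distrib_right) (simp add: C_def)
qed

lemma eq_tanh_iff_even:
  fixes g :: "real fps"
  assumes "g $ 0 \<noteq> 0"
  shows "(\<exists>\<rho>. fps_even \<rho> \<and> \<rho> $ 0 = 1 \<and> g = fps_const (g $ 0 / 2) * (2 * \<rho> * (1 + fps_tanh k)))
    \<longleftrightarrow> fps_even (g * fps_exp (- k))"
proof -
  define C where "C = fps_exp k + fps_exp (- k)"
  define d where "d = g $ 0"
  have C: "C $ 0 = 2" "C oo - fps_X = C"
    by (simp_all add: C_def fps_compose_add_distrib add.commute)
  have "C \<noteq> 0" using C(1) by auto
  have tanh: "(1 + fps_tanh k) * C = 2 * fps_exp k"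
    unfolding C_def by (rule one_plus_fps_tanh)
  \<comment> \<open>Multiplying by \<open>C\<close> clears the denominator of the tangent and leaves
    \<open>2 * fps_exp k\<close>, which moves to the other side; the constants combine to
    \<open>d / 2 * 2 * 2 = 2 * d\<close>.\<close>
  have rep: "g = fps_const (d / 2) * (2 * \<rho> * (1 + fps_tanh k))
      \<longleftrightarrow> g * fps_exp (- k) * C = fps_const (2 * d) * \<rho>" for \<rho>
  proof -
    have "g = fps_const (d / 2) * (2 * \<rho> * (1 + fps_tanh k))
        \<longleftrightarrow> g * C = fps_const (d / 2) * (2 * \<rho> * (1 + fps_tanh k)) * C"
      using \<open>C \<noteq> 0\<close> by simp
    also have "fps_const (d / 2) * (2 * \<rho> * (1 + fps_tanh k)) * C
        = fps_const (d / 2) * 2 * \<rho> * ((1 + fps_tanh k) * C)"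
      by (simp only: mult_ac)
    also have "\<dots> = fps_const (2 * d) * \<rho> * fps_exp k"
      unfolding tanh by (simp add: fps_eq_iff numeral_fps_const mult_ac)
    also have "g * C = \<dots> \<longleftrightarrow> g * fps_exp (- k) * C = fps_const (2 * d) * \<rho>"
      unfolding eq_commute[of "g * C"] fps_mult_exp_eq_iff by (auto simp: mult_ac)
    finally show ?thesis .
  qed
  show ?thesis unfolding d_def[symmetric] rep
  proof (intro iffI; (elim exE conjE)?)
    fix \<rho> assume \<rho>: "fps_even \<rho>" and eq: "g * fps_exp (- k) * C = fps_const (2 * d) * \<rho>"
    have "(g * fps_exp (- k) oo - fps_X) * C = (g * fps_exp (- k) * C) oo - fps_X"
      by (simp add: fps_compose_mult_distrib[of "- fps_X"] C del: fps_fps_exp_compose_minus)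
    also have "\<dots> = g * fps_exp (- k) * C"
      unfolding eq using \<rho> by (simp add: fps_even_def fps_compose_mult_distrib)
    finally show "fps_even (g * fps_exp (- k))"
      using \<open>C \<noteq> 0\<close> by (simp add: fps_even_def)
  next
    assume even: "fps_even (g * fps_exp (- k))"
    \<comment> \<open>This solves \<open>rep\<close> for \<open>\<rho>\<close>. The constant
      coefficient is 1 because \<open>g\<close> contributes \<open>d\<close> and \<open>C\<close>
      contributes 2.\<close>
    define \<rho> where "\<rho> = fps_const (1 / (2 * d)) * (g * fps_exp (- k) * C)"
    have "fps_even \<rho>"
      using even C unfolding fps_even_def \<rho>_def
      by (simp add: fps_compose_mult_distrib[of "- fps_X"] del: fps_fps_exp_compose_minus)
    moreover have "\<rho> $ 0 = 1"
      using assms C by (simp add: \<rho>_def d_def)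
    moreover have "g * fps_exp (- k) * C = fps_const (2 * d) * \<rho>"
      using assms by (simp add: \<rho>_def d_def mult.assoc[symmetric])
    ultimately show "\<exists>\<rho>. fps_even \<rho> \<and> \<rho> $ 0 = 1 \<and> g * fps_exp (- k) * C = fps_const (2 * d) * \<rho>"
      by blast
  qed
qed

text \<open>A series \<open>2 * \<rho> * (1 + fps_tanh k)\<close> with \<open>\<rho> $ 0 = 1\<close>
  has constant coefficient 2, whereas scaling \<open>g\<close> by a nonzero constant does not move
  the zeros. The converse therefore carries the factor \<open>g $ 0 / 2\<close>.\<close>

theorem theorem6:
  fixes g :: "real fps" and a :: real and G :: "nat \<Rightarrow> complex poly"
  assumes "g $ 0 \<noteq> 0" and "a \<noteq> 0" and "appell_sequence g a G"
  shows "(\<forall>\<rho> k. fps_even \<rho> \<and> \<rho> $ 0 = 1 \<and> g = 2 * \<rho> * (1 + fps_tanh k)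
            \<longrightarrow> (\<forall>n\<ge>1. zeros_symmetric (- k / a) (G n)))
       \<and> ((\<exists>\<kappa>. \<forall>n\<ge>1. zeros_symmetric \<kappa> (G n))
            \<longrightarrow> (\<exists>\<rho> k. fps_even \<rho> \<and> \<rho> $ 0 = 1
                    \<and> g = fps_const (g $ 0 / 2) * (2 * \<rho> * (1 + fps_tanh k))))"
proof (intro conjI allI impI)
  note symmetric_iff = appell_zeros_symmetric_iff[OF assms(3,1,2)]
  {
    fix \<rho> k and n :: nat
    assume rep: "fps_even \<rho> \<and> \<rho> $ 0 = 1 \<and> g = 2 * \<rho> * (1 + fps_tanh k)" and "n \<ge> 1"
    \<comment> \<open>This forces \<open>g $ 0 = 2\<close>, so the factor \<open>g $ 0 / 2\<close>
      in \<open>eq_tanh_iff_even\<close> becomes 1.\<close>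
    have "fps_tanh k $ 0 = 0"
      by (simp add: fps_tanh_def fps_divide_unit)
    then have "g $ 0 = 2"
      using rep by (simp add: numeral_fps_const)
    then have "fps_even (g * fps_exp (- k))"
      using rep eq_tanh_iff_even[OF assms(1), of k] by auto
    then show "zeros_symmetric (- k / a) (G n)"
      using symmetric_iff[of "- k / a"] \<open>a \<noteq> 0\<close> \<open>n \<ge> 1\<close> by simp
  next
    assume "\<exists>\<kappa>. \<forall>n\<ge>1. zeros_symmetric \<kappa> (G n)"
    \<comment> \<open>The double negation exhibits \<open>k = - a * \<kappa>\<close>, the inverse of
      \<open>\<kappa> = - k / a\<close>.\<close>
    then obtain \<kappa> where "fps_even (g * fps_exp (- (- a * \<kappa>)))"
      using symmetric_iff by auto
    then show "\<exists>\<rho> k. fps_even \<rho> \<and> \<rho> $ 0 = 1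
        \<and> g = fps_const (g $ 0 / 2) * (2 * \<rho> * (1 + fps_tanh k))"
      using eq_tanh_iff_even[OF assms(1)] by blast
  }
qed

end
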